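(* There exists an oriented graph $D$ with $c(D) = 2$ such that $D$ has exactly one source (vertex of in-degree $0$) and every directed cycle of $D$ is cop-dominated.
   Context: All graphs are finite. An oriented graph is a directed graph without loops and without parallel or opposite arcs, i.e. a simple undirected graph each of whose edges has been assigned one direction. Game of cops and robbers with $k$ cops on a digraph: first each of the $k$ cops chooses a starting vertex (several cops may share a vertex), then the robber chooses a starting vertex. The game proceeds in rounds: in each round every cop either stays in place or moves along an arc (from its tail to its head), after which the robber either stays in place or moves along an arc. All positions are known to everyone. The cops win if after finitely many rounds some cop occupies the same vertex as the robber; the robber wins if he avoids this forever. The cop number $c(D)$ is the least $k$ for which $k$ cops have a winning strategy. A directed cycle $C$ of $D$ is cop-dominated if, in the game played with one cop, the robber cannot avoid capture by entering $C$ (by some path) and then moving around on $C$ for the rest of the game; that is, for the given cycle $C$ one cop has a strategy (including the choice of starting vertex) such that the robber is captured in every play in which, from some point on, he remains on vertices of $C$ for the rest of the game. *)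

theory Defs
  imports "Graph_Theory.Digraph" "Graph_Theory.Arc_Walk"
begin

locale oriented_graph = digraph +
  assumes no_opposite_arcs: "u \<rightarrow>\<^bsub>G\<^esub> v \<Longrightarrow> \<not> v \<rightarrow>\<^bsub>G\<^esub> u"

definition source :: "('a, 'b) pre_digraph \<Rightarrow> 'a \<Rightarrow> bool" where
  "source G v \<longleftrightarrow> v \<in> verts G \<and> in_degree G v = 0"

definition legal_move :: "('a, 'b) pre_digraph \<Rightarrow> 'a \<Rightarrow> 'a \<Rightarrow> bool" where
  "legal_move G u v \<longleftrightarrow> v = u \<or> u \<rightarrow>\<^bsub>G\<^esub> v"

definition robber_play :: "('a, 'b) pre_digraph \<Rightarrow> (nat \<Rightarrow> 'a) \<Rightarrow> bool" where
  "robber_play G r \<longleftrightarrow> r 0 \<in> verts G \<and> (\<forall>n. legal_move G (r n) (r (Suc n)))"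

text \<open>
  A cop strategy maps the list of all positions the robber has occupied so far to the list of
  the cops' next positions (the \<open>i\<close>-th entry belongs to the \<open>i\<close>-th cop); on the empty list it
  gives the initial placement. The cops' own earlier positions are determined by the strategy and
  the robber's positions, so this covers all strategies with perfect recall.
  The order of play against \<open>r\<close> is
  \<open>cops_at s r 0, r 0, cops_at s r 1, r 1, cops_at s r 2, r 2, \<dots>\<close>
\<close>

type_synonym 'a cop_strategy = "'a list \<Rightarrow> 'a list"

definition cops_at :: "'a cop_strategy \<Rightarrow> (nat \<Rightarrow> 'a) \<Rightarrow> nat \<Rightarrow> 'a list" where
  "cops_at s r n = s (map r [0..<n])"

definition legal_strategy :: "('a, 'b) pre_digraph \<Rightarrow> nat \<Rightarrow> 'a cop_strategy \<Rightarrow> bool" where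
  "legal_strategy G k s \<longleftrightarrow>
     length (s []) = k \<and> set (s []) \<subseteq> verts G \<and>
     (\<forall>r n. robber_play G r \<longrightarrow> list_all2 (legal_move G) (cops_at s r n) (cops_at s r (Suc n)))"

text \<open>Capture can occur after a move of the robber or after a move of the cops.\<close>

definition captures :: "'a cop_strategy \<Rightarrow> (nat \<Rightarrow> 'a) \<Rightarrow> bool" where
  "captures s r \<longleftrightarrow> (\<exists>n. r n \<in> set (cops_at s r n) \<or> r n \<in> set (cops_at s r (Suc n)))"

definition cops_win :: "('a, 'b) pre_digraph \<Rightarrow> nat \<Rightarrow> bool" where
  "cops_win G k \<longleftrightarrow> (\<exists>s. legal_strategy G k s \<and> (\<forall>r. robber_play G r \<longrightarrow> captures s r))"

definition cop_number :: "('a, 'b) pre_digraph \<Rightarrow> nat" where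
  "cop_number G = (LEAST k. cops_win G k)"

text \<open>The minimum in the definition of the cop number exists for every finite digraph.\<close>

lemma (in fin_digraph) cops_win_card_verts: "cops_win G (card (verts G))"
proof -
  obtain vs where vs: "set vs = verts G" "distinct vs"
    using finite_distinct_list[OF finite_verts] by blast
  have "legal_strategy G (card (verts G)) (\<lambda>_. vs)"
    using vs distinct_card[OF vs(2)]
    by (auto simp: legal_strategy_def cops_at_def legal_move_def intro: list_all2_refl)
  moreover have "captures (\<lambda>_. vs) r" if "robber_play G r" for r
    using that vs by (auto simp: captures_def cops_at_def robber_play_def)
  ultimately show ?thesis
    unfolding cops_win_def by blast
qed

text \<open>
  A cycle is given by its list of arcs \<open>C\<close>, so its vertices are the tails of these arcs. The
  robber may enter the cycle at any time \<open>N\<close>, unknown to the cop; from then on he has to stay on the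
  vertices of the cycle.
\<close>

definition cop_dominated :: "('a, 'b) pre_digraph \<Rightarrow> 'b list \<Rightarrow> bool" where
  "cop_dominated G C \<longleftrightarrow>
     (\<exists>s. legal_strategy G 1 s \<and>
       (\<forall>r. robber_play G r \<and> (\<exists>N. \<forall>n\<ge>N. r n \<in> tail G ` set C) \<longrightarrow> captures s r))"

end

theory Submission
  imports Defs
begin

text \<open>
  The robber lives on two directed triangles, on \<open>{3,4,5}\<close> and \<open>{3,6,7}\<close>, glued at vertex 3.
  A guard 1 sends arcs to all of the first triangle, a guard 2 to all of the second one, and the
  source 0 sends arcs to both guards. These triangles are the only cycles, and a single cop waiting
  on its guard dominates a triangle. A single cop nevertheless loses: the robber waits at 3 until
  the cop commits to a guard, then steps into the other triangle, and once the cop is on the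
  triangles he steps away along his triangle whenever he is threatened. Two cops win from 0 and 1.
\<close>

section \<open>General facts: evading one cop, guarding a cycle, arcs of a cycle\<close>

text \<open>The robber survives by maintaining \<open>P\<close> as an invariant of the positions
  right after each of his own moves.\<close>

lemma not_cops_win_one_if_evasion:
  assumes start: "\<And>c. c \<in> verts G \<Longrightarrow> \<exists>u\<in>verts G. P c u"
    and step: "\<And>c u c'. P c u \<Longrightarrow> legal_move G c c' \<Longrightarrow> \<exists>u'. legal_move G u u' \<and> P c' u'"
    and safe: "\<And>c u c'. P c u \<Longrightarrow> legal_move G c c' \<Longrightarrow> u \<noteq> c'"
  shows "\<not> cops_win G 1"
proof
  assume "cops_win G 1"
  then obtain s where s: "legal_strategy G 1 s" and win: "\<And>r. robber_play G r \<Longrightarrow> captures s r"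
    by (auto simp: cops_win_def)
  have s0: "hd (s []) \<in> verts G" "length (s []) = 1"
    using s by (cases "s []"; auto simp: legal_strategy_def)+
  obtain u0 where u0: "u0 \<in> verts G" "P (hd (s [])) u0"
    using start s0 by blast
  define respond where "respond c' u = (SOME u'. legal_move G u u' \<and> P c' u')" for c' u
  have respond: "legal_move G u (respond c' u) \<and> P c' (respond c' u)"
    if "P c u" "legal_move G c c'" for c c' u
    unfolding respond_def using step[OF that] by (rule someI_ex)
  \<comment> \<open>A strategy reads the whole history, so the recursion builds the list of the
    robber's positions rather than a single position.\<close>
  define hist where "hist = rec_nat [u0] (\<lambda>n h. h @ [respond (hd (s h)) (last h)])"
  define r where "r n = last (hist n)" for n
  have hist_Suc: "hist (Suc n) = hist n @ [respond (hd (s (hist n))) (last (hist n))]" for n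
    by (simp add: hist_def)
  have hist: "hist n = map r [0..<Suc n]" for n
  proof (induction n)
    case 0
    show ?case by (simp add: r_def hist_def)
  next
    case (Suc n)
    have "hist (Suc n) = hist n @ [r (Suc n)]"
      by (simp add: r_def hist_Suc)
    then show ?case using Suc by simp
  qed
  define c where "c n = hd (cops_at s r n)" for n
  have r_0: "r 0 = u0"
    by (simp add: r_def hist_def)
  have r_Suc: "r (Suc n) = respond (c (Suc n)) (r n)" for n
    unfolding c_def cops_at_def hist[symmetric] by (simp add: r_def hist_Suc)
  text \<open>Strategies are only constrained on full plays, so the play up to time \<open>n\<close> is prolonged
    by a robber who stays put.\<close>
  have cop_legal: "list_all2 (legal_move G) (cops_at s r n) (cops_at s r (Suc n))"
    if "\<forall>i<n. legal_move G (r i) (r (Suc i))" for n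
  proof -
    define r' where "r' i = r (min i n)" for i
    have "robber_play G r'"
      unfolding robber_play_def
    proof (intro conjI allI)
      show "r' 0 \<in> verts G"
        using u0 r_0 by (simp add: r'_def)
      show "legal_move G (r' i) (r' (Suc i))" for i
        using that by (cases "i < n") (auto simp: r'_def legal_move_def min_def)
    qed
    moreover have "cops_at s r' m = cops_at s r m" if "m \<le> Suc n" for m
    proof -
      have "map r' [0..<m] = map r [0..<m]"
        using that by (auto simp: r'_def)
      then show ?thesis
        unfolding cops_at_def by (rule arg_cong)
    qed
    then have "cops_at s r' n = cops_at s r n" "cops_at s r' (Suc n) = cops_at s r (Suc n)"
      by simp_all
    ultimately show ?thesis
      using s by (metis legal_strategy_def)
  qed
  \<comment> \<open>Legality of the two players is interlocked: a reply is known to be legal only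
    after a legal cop move, which in turn rests on a legal robber history. Hence the joint
    induction.\<close>
  have inv: "P (c n) (r n) \<and> length (cops_at s r n) = 1 \<and>
      (\<forall>i<n. legal_move G (r i) (r (Suc i)))" for n
  proof (induction n)
    case 0
    show ?case using u0 s0 r_0 by (simp add: c_def cops_at_def)
  next
    case (Suc n)
    then have l: "list_all2 (legal_move G) (cops_at s r n) (cops_at s r (Suc n))"
      using cop_legal by blast
    moreover from l Suc have "length (cops_at s r (Suc n)) = 1"
      by (metis list_all2_lengthD)
    ultimately have "legal_move G (c n) (c (Suc n))"
      using Suc unfolding c_def by (metis list_all2_Cons length_0_conv list.exhaust_sel zero_neq_one)
    then show ?case
      using Suc respond[of "c n" "r n" "c (Suc n)"] r_Suc \<open>length (cops_at s r (Suc n)) = 1\<close>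
      by (auto simp: less_Suc_eq)
  qed
  have cops: "cops_at s r n = [c n]" for n
    using inv[of n] by (cases "cops_at s r n") (auto simp: c_def)
  have "robber_play G r"
    using inv u0 r_0 by (auto simp: robber_play_def)
  from win[OF this] obtain n where "r n = c n \<or> r n = c (Suc n)"
    unfolding captures_def cops by auto
  moreover have "legal_move G (c n) (c (Suc n))"
    using cop_legal[of n] inv[of n] by (simp add: cops)
  \<comment> \<open>Staying put is a legal cop move, so \<open>safe\<close> also excludes
    \<open>r n = c n\<close>, a capture by the robber's own move.\<close>
  ultimately show False
    using safe[of "c n" "r n"] inv[of n] by (auto simp: legal_move_def)
qed

text \<open>The cop waits at \<open>x\<close> until the robber first stands on the cycle and then
  takes him along the arc from \<open>x\<close>.\<close>

lemma cop_dominated_if_guard: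
  assumes "x \<in> verts G" and guard: "\<And>w. w \<in> tail G ` set C \<Longrightarrow> x \<rightarrow>\<^bsub>G\<^esub> w"
  shows "cop_dominated G C"
proof -
  define V where "V = tail G ` set C"
  \<comment> \<open>Once \<open>find\<close> has met a cycle vertex, longer histories give the same
    one, so after leaving \<open>x\<close> the cop never moves again.\<close>
  define s where "s h = [case find (\<lambda>w. w \<in> V) h of None \<Rightarrow> x | Some w \<Rightarrow> w]" for h
  have find_snoc: "find Q (xs @ [y]) =
    (case find Q xs of None \<Rightarrow> if Q y then Some y else None | Some z \<Rightarrow> Some z)"
    for Q and xs :: "'a list" and y
    by (induction xs) auto
  have "legal_strategy G 1 s"
    using assms by (auto simp: legal_strategy_def s_def cops_at_def find_snoc legal_move_def V_def
        split: option.splits)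
  moreover have "captures s r" if tail: "\<forall>n\<ge>N. r n \<in> V" for r N
  proof -
    define n where "n = (LEAST n. r n \<in> V)"
    have n: "r n \<in> V"
      unfolding n_def by (rule LeastI[of "\<lambda>n. r n \<in> V" N, OF spec[OF tail, THEN mp]]) simp
    have "r i \<notin> V" if "i < n" for i
      using that not_less_Least unfolding n_def by blast
    then have "find (\<lambda>w. w \<in> V) (map r [0..<n]) = None"
      by (auto simp: find_None_iff)
    then have "s (map r [0..<Suc n]) = [r n]"
      using n by (simp add: s_def find_snoc)
    then show ?thesis
      unfolding captures_def cops_at_def by (intro exI[of _ n]) simp
  qed
  ultimately show ?thesis
    unfolding cop_dominated_def V_def by blast
qed

text \<open>This makes cycles accessible to local arguments: no two cycle arcs enter the same
  vertex, and every cycle vertex has a predecessor and a successor on the cycle.\<close>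

lemma (in wf_digraph) cycle_heads:
  assumes "cycle C"
  shows "inj_on (head G) (set C)" and "head G ` set C = tail G ` set C"
proof -
  obtain u where walk: "awalk u C u" and dist: "distinct (tl (awalk_verts u C))" and "C \<noteq> []"
    using assms by (auto simp: cycle_def)
  \<comment> \<open>Both sides are the vertex sequence of the walk, read off from tails or from
    heads.\<close>
  have shift: "map (tail G) p @ [y] = x # map (head G) p" if "cas x p y" for x y p
    using that by (induction x p y rule: cas.induct) auto
  have eq: "map (tail G) C @ [u] = u # map (head G) C"
    using walk by (intro shift) (simp add: awalk_def)
  have "awalk_verts u C = u # map (head G) C"
    unfolding eq[symmetric] using \<open>C \<noteq> []\<close> arg_cong[OF eq, of last]
    by (simp add: awalk_verts_conv last_map)
  with dist show "inj_on (head G) (set C)"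
    by (simp add: distinct_map)
  \<comment> \<open>The walk is closed at \<open>u\<close>, so \<open>u\<close> is both a tail and a
    head, and \<open>insert u\<close> can be cancelled on both sides below.\<close>
  have "u \<in> set (map (tail G) C)"
    using eq \<open>C \<noteq> []\<close> by (cases C) auto
  moreover have "u \<in> set (map (head G) C)"
    using arg_cong[OF eq, of last] \<open>C \<noteq> []\<close> by (cases C rule: rev_cases) auto
  moreover have "insert u (set (map (tail G) C)) = insert u (set (map (head G) C))"
    using arg_cong[OF eq, of set] by simp
  ultimately show "head G ` set C = tail G ` set C"
    by (simp add: insert_absorb)
qed

section \<open>The two-triangle digraph and its cycles\<close>

definition two_triangle_arcs :: "(nat \<times> nat) set" where
  "two_triangle_arcs = {(0,1), (0,2), (1,3), (1,4), (1,5), (2,3), (2,6), (2,7),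
     (3,4), (4,5), (5,3), (3,6), (6,7), (7,3)}"

definition two_triangles :: "(nat, nat \<times> nat) pre_digraph" where
  "two_triangles = \<lparr>verts = {0,1,2,3,4,5,6,7}, arcs = two_triangle_arcs, tail = fst, head = snd\<rparr>"

lemma two_triangles_simps [simp]:
  "verts two_triangles = {0,1,2,3,4,5,6,7}"
  "arcs two_triangles = two_triangle_arcs"
  "tail two_triangles = fst"
  "head two_triangles = snd"
  by (simp_all add: two_triangles_def)

lemma adj_two_triangles: "u \<rightarrow>\<^bsub>two_triangles\<^esub> v \<longleftrightarrow> (u, v) \<in> two_triangle_arcs"
  by (simp add: arcs_ends_def arc_to_ends_def)

lemma oriented_graph_two_triangles: "oriented_graph two_triangles"
proof
  have "\<forall>(u, v) \<in> two_triangle_arcs. (v, u) \<notin> two_triangle_arcs"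
    by (simp add: two_triangle_arcs_def)
  then show "\<not> v \<rightarrow>\<^bsub>two_triangles\<^esub> u" if "u \<rightarrow>\<^bsub>two_triangles\<^esub> v" for u v
    using that unfolding adj_two_triangles by blast
  have "\<forall>e \<in> two_triangle_arcs. fst e \<in> verts two_triangles \<and> snd e \<in> verts two_triangles \<and> fst e \<noteq> snd e"
    by (simp add: two_triangle_arcs_def)
  then show "tail two_triangles e \<in> verts two_triangles" "head two_triangles e \<in> verts two_triangles"
      "tail two_triangles e \<noteq> head two_triangles e"
    if "e \<in> arcs two_triangles" for e
    using that by simp_all
  show "finite (arcs two_triangles)"
    by (simp add: two_triangle_arcs_def)
  show "e = e'" if "arc_to_ends two_triangles e = arc_to_ends two_triangles e'" for e e'
    using that by (simp add: arc_to_ends_def prod_eq_iff)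
qed simp

lemma source_two_triangles: "source two_triangles v \<longleftrightarrow> v = 0"
proof -
  interpret oriented_graph two_triangles by (rule oriented_graph_two_triangles)
  have "in_degree two_triangles v = 0 \<longleftrightarrow> in_arcs two_triangles v = {}"
    by (simp add: in_degree_def finite_in_arcs)
  then show ?thesis
    by (auto simp: source_def in_arcs_def two_triangle_arcs_def)
qed

text \<open>A cycle can neither leave the triangles nor use both of them, since it would then enter
  3 twice; so 1 or 2 guards it.\<close>

lemma cop_dominated_two_triangles:
  assumes "pre_digraph.cycle two_triangles C"
  shows "cop_dominated two_triangles C"
proof -
  interpret oriented_graph two_triangles by (rule oriented_graph_two_triangles)
  define V where "V = fst ` set C"
  have sub: "set C \<subseteq> two_triangle_arcs"
    using assms by (auto simp: cycle_def awalk_def)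
  have inj: "inj_on snd (set C)" and heads: "snd ` set C = V"
    using cycle_heads[OF assms] by (simp_all add: V_def)
  have pred: "\<exists>u. (u, v) \<in> set C \<and> u \<in> V" if v: "v \<in> V" for v
  proof -
    obtain u where "(u, v) \<in> set C"
      using v unfolding heads[symmetric] by auto
    then have "u \<in> V" unfolding V_def by (auto intro: rev_image_eqI)
    with \<open>(u, v) \<in> set C\<close> show ?thesis by blast
  qed
  have succ: "\<exists>w. (v, w) \<in> set C \<and> w \<in> V" if v: "v \<in> V" for v
  proof -
    obtain w where "(v, w) \<in> set C"
      using v unfolding V_def by auto
    then have "w \<in> snd ` set C" by (auto intro: rev_image_eqI)
    with \<open>(v, w) \<in> set C\<close> show ?thesis unfolding heads by blast
  qed
  have arc: "e \<in> two_triangle_arcs" if "e \<in> set C" for e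
    using sub that by blast
  have ends: "(u, 0) \<notin> two_triangle_arcs"
    "(u, 1) \<in> two_triangle_arcs \<Longrightarrow> u = 0" "(u, 2) \<in> two_triangle_arcs \<Longrightarrow> u = 0"
    "(4, u) \<in> two_triangle_arcs \<Longrightarrow> u = 5" "(5, u) \<in> two_triangle_arcs \<Longrightarrow> u = 3"
    "(6, u) \<in> two_triangle_arcs \<Longrightarrow> u = 7" "(7, u) \<in> two_triangle_arcs \<Longrightarrow> u = 3"
    "(u, w) \<in> two_triangle_arcs \<Longrightarrow> u \<in> {0,1,2,3,4,5,6,7}" for u w
    by (simp_all add: two_triangle_arcs_def, elim disjE, simp_all)
  \<comment> \<open>Every cycle vertex has a predecessor on the cycle: this excludes the source, and
    then 1 and 2, whose only in-neighbour is 0.\<close>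
  have no0: "0 \<notin> V"
    by (metis pred arc ends(1))
  have no1: "1 \<notin> V" and no2: "2 \<notin> V"
    by (metis pred arc ends(2) no0, metis pred arc ends(3) no0)
  have V: "V \<subseteq> {3,4,5,6,7}"
  proof
    fix u assume u: "u \<in> V"
    then have "u \<in> {0,1,2,3,4,5,6,7}"
      by (metis succ arc ends(8))
    with u no0 no1 no2 show "u \<in> {3,4,5,6,7}" by blast
  qed
  \<comment> \<open>The vertices other than 3 have a single out-arc each, which forces the cycle
    along the rest of the triangle back to 3.\<close>
  have A: "(5, 3) \<in> set C" if "4 \<in> V \<or> 5 \<in> V"
    using that by (metis succ arc ends(4,5))
  have B: "(7, 3) \<in> set C" if "6 \<in> V \<or> 7 \<in> V"
    using that by (metis succ arc ends(6,7))
  have "\<not> ((5, 3) \<in> set C \<and> (7, 3) \<in> set C)"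
    using inj_onD[OF inj, of "(5, 3)" "(7, 3)"] by auto
  with A B V consider "V \<subseteq> {3,4,5}" | "V \<subseteq> {3,6,7}"
    by blast
  then show ?thesis
  proof cases
    case 1
    show ?thesis
      by (rule cop_dominated_if_guard[of 1])
        (use 1[unfolded V_def] in \<open>auto simp: adj_two_triangles two_triangle_arcs_def\<close>)
  next
    case 2
    show ?thesis
      by (rule cop_dominated_if_guard[of 2])
        (use 2[unfolded V_def] in \<open>auto simp: adj_two_triangles two_triangle_arcs_def\<close>)
  qed
qed

section \<open>The cop number\<close>

text \<open>A robber starting on the first triangle is taken at once from 1. Meanwhile the cop from
  0 reaches 2, and a robber starting at 6 or 7 is still within its reach after his next
  move.\<close>

lemma cops_win_two_triangles: "cops_win two_triangles 2"
proof -
  \<comment> \<open>Here \<open>u\<close> is \<open>r 0\<close> and \<open>hd us\<close> is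
    \<open>r 1\<close>. The tests on them make the cop moves legal against any sequence
    \<open>r\<close>.\<close>
  define s :: "nat cop_strategy" where
    "s h = (case h of [] \<Rightarrow> [0, 1]
      | u # us \<Rightarrow> [if us \<noteq> [] \<and> u \<in> {6,7} \<and> hd us \<in> {3,6,7} then hd us else 2,
                  if u \<in> {3,4,5} then u else 1])" for h
  have upt: "[0..<Suc (Suc n)] = 0 # 1 # [2..<Suc (Suc n)]" for n
    by (simp add: upt_conv_Cons numeral_2_eq_2)
  have s1: "cops_at s r (Suc 0) = [2, if r 0 \<in> {3,4,5} then r 0 else 1]" for r
    by (simp add: cops_at_def s_def)
  have s2: "cops_at s r (Suc (Suc n)) =
      [if r 0 \<in> {6,7} \<and> r 1 \<in> {3,6,7} then r 1 else 2, if r 0 \<in> {3,4,5} then r 0 else 1]" for r n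
    unfolding cops_at_def upt by (simp add: s_def)
  have "list_all2 (legal_move two_triangles) (cops_at s r n) (cops_at s r (Suc n))" for r n
  proof (cases n)
    case 0
    then show ?thesis
      unfolding s1 0 by (auto simp: cops_at_def s_def legal_move_def adj_two_triangles two_triangle_arcs_def)
  next
    case (Suc m)
    then show ?thesis
      by (cases m) (auto simp: s1 s2 legal_move_def adj_two_triangles two_triangle_arcs_def)
  qed
  then have "legal_strategy two_triangles 2 s"
    by (simp add: legal_strategy_def s_def)
  moreover have "captures s r" if r: "robber_play two_triangles r" for r
  proof (cases "r 0 \<in> {6,7}")
    case True
    have "legal_move two_triangles (r 0) (r (Suc 0))"
      using r by (simp add: robber_play_def)
    then have "r 1 \<in> {3,6,7}"
      using True by (auto simp: legal_move_def adj_two_triangles two_triangle_arcs_def)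
    then show ?thesis
      unfolding captures_def using True by (intro exI[of _ 1]) (simp add: s2)
  next
    case False
    have "r 0 \<in> verts two_triangles"
      using r by (simp add: robber_play_def)
    then have "r 0 \<in> set (cops_at s r 0) \<or> r 0 \<in> set (cops_at s r (Suc 0))"
      using False unfolding s1 by (auto simp: cops_at_def s_def)
    then show ?thesis
      unfolding captures_def by blast
  qed
  ultimately show ?thesis
    unfolding cops_win_def by blast
qed

lemma not_cops_win_zero:
  assumes "v \<in> verts G"
  shows "\<not> cops_win G 0"
proof
  assume "cops_win G 0"
  then obtain s where s: "legal_strategy G 0 s" and "\<And>r. robber_play G r \<Longrightarrow> captures s r"
    by (auto simp: cops_win_def)
  moreover have play: "robber_play G (\<lambda>_. v)"
    using assms by (simp add: robber_play_def legal_move_def)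
  moreover have "cops_at s (\<lambda>_. v) n = []" for n
  proof (induction n)
    case 0
    show ?case using s by (simp add: legal_strategy_def cops_at_def)
  next
    case (Suc n)
    then show ?case using s play by (metis legal_strategy_def list_all2_Nil)
  qed
  ultimately show False
    by (force simp: captures_def)
qed

text \<open>The robber avoids a cop at \<open>c\<close> by keeping to these vertices after his own move; the source
  serves against a cop who did not start there.\<close>

definition evading :: "nat \<Rightarrow> nat set" where
  "evading c = (if c = 0 then {3} else if c = 1 then {0,6,7} else if c = 2 then {0,4,5}
     else if c = 3 then {0,5,7} else if c = 4 then {0,3,6,7} else if c = 5 then {0,4,6,7}
     else if c = 6 then {0,3,4,5} else if c = 7 then {0,4,5,6} else {})"

text \<open>For \<open>c\<close> other than 0, \<open>evading c\<close> holds 0 and all triangle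
  vertices that the cop cannot reach in one move. Against a cop at 0 only 3 is kept, from where
  either triangle can still be chosen.\<close>

lemma not_cops_win_one_two_triangles: "\<not> cops_win two_triangles 1"
proof (rule not_cops_win_one_if_evasion[where P = "\<lambda>c u. u \<in> evading c"])
  show "\<exists>u\<in>verts two_triangles. u \<in> evading c" if "c \<in> verts two_triangles" for c
    using that by (auto simp: evading_def)
next
  fix c u c'
  assume u: "u \<in> evading c" and c': "legal_move two_triangles c c'"
  note moves = legal_move_def adj_two_triangles two_triangle_arcs_def
  have "c \<in> {0,1,2,3,4,5,6,7}"
    using u by (auto simp: evading_def split: if_splits)
  \<comment> \<open>The listed pairs are the threats that can arise after the cop's move; otherwise
    the robber just stays.\<close>
  then have safe: "u \<noteq> c' \<and> (u \<in> evading c' \<or>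
      (c', u) \<in> {(1,3), (2,3), (3,4), (3,6), (4,5), (5,3), (6,7), (7,3)})"
    unfolding insert_iff empty_iff
    by (elim disjE FalseE) (use u c' in \<open>auto simp: evading_def moves\<close>)
  then show "u \<noteq> c'" by blast
  \<comment> \<open>Triples of cop, robber and escape move, one for each threat. From 3 the robber
    escapes into the triangle not containing or guarded by the cop; for a cop at 3 he continues
    along his own.\<close>
  define T :: "(nat \<times> nat \<times> nat) set" where
    "T = {(1,3,6), (2,3,4), (3,4,5), (3,6,7), (4,5,3), (5,3,6), (6,7,3), (7,3,4)}"
  have T: "\<forall>(c, u, u') \<in> T. (u, u') \<in> two_triangle_arcs \<and> u' \<in> evading c"
    by (simp add: T_def two_triangle_arcs_def evading_def)
  have "u \<in> evading c' \<or> (\<exists>u'. (c', u, u') \<in> T)"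
    using safe unfolding T_def by blast
  then show "\<exists>u'. legal_move two_triangles u u' \<and> u' \<in> evading c'"
  proof
    assume "\<exists>u'. (c', u, u') \<in> T"
    then obtain u' where "(c', u, u') \<in> T" ..
    with T have "(u, u') \<in> two_triangle_arcs \<and> u' \<in> evading c'"
      by fast
    then show ?thesis
      unfolding legal_move_def adj_two_triangles by blast
  qed (auto simp: legal_move_def)
qed

lemma cop_number_two_triangles: "cop_number two_triangles = 2"
  unfolding cop_number_def
proof (rule Least_equality[where P = "cops_win two_triangles", OF cops_win_two_triangles])
  show "2 \<le> k" if "cops_win two_triangles k" for k
  proof (rule ccontr)
    assume "\<not> 2 \<le> k"
    then have "k = 0 \<or> k = 1" by auto
    with that show False
      using not_cops_win_zero[of 0 two_triangles] not_cops_win_one_two_triangles by auto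
  qed
qed

theorem theorem13:
  shows "\<exists>D :: (nat, nat \<times> nat) pre_digraph.
    oriented_graph D \<and> cop_number D = 2 \<and> (\<exists>!v. source D v) \<and>
    (\<forall>C. pre_digraph.cycle D C \<longrightarrow> cop_dominated D C)"
proof (intro exI[of _ two_triangles] conjI allI impI)
  show "\<exists>!v. source two_triangles v"
    by (simp add: source_two_triangles)
qed (simp_all only: oriented_graph_two_triangles cop_number_two_triangles cop_dominated_two_triangles)

end
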